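(* Let $q\ge1$, $n\ge q$ and $m\ge 1$ be integers and let $\lambda(x)=\sum_{d=0}^{q}\lambda_d x^d$ be a probability distribution on $\{0,\dots,q\}$. Consider coded slotted ALOHA with $m$ users, $n$ slots and degree distribution $\lambda$, and for $d\in\{1,\dots,q\}$ let $\bar w_d$ be the expected number of unresolved users of degree $d$. Let $\mathcal A$ be the set of all stopping sets (up to isomorphism) having at most $m$ variable nodes, each of degree at most $q$, and at most $n$ check nodes. Then for every $d\in\{1,\dots,q\}$, $$\bar w_d\ \le\ \sum_{\mathcal S\in\mathcal A} v_d(\mathcal S)\,\alpha(\mathcal S)\,\beta(\mathcal S)\,\gamma(\mathcal S),$$ where $$\alpha(\mathcal S)=\frac{m!}{(m-\nu(\mathcal S))!}\prod_{k=1}^{q}\frac{\lambda_k^{v_k(\mathcal S)}}{v_k(\mathcal S)!},\qquad \beta(\mathcal S)=\binom{n}{\mu(\mathcal S)},\qquad \gamma(\mathcal S)=\frac{c(\mathcal S)}{\prod_{k=1}^{q}\binom{n}{k}^{v_k(\mathcal S)}} .$$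
   Context: Coded slotted ALOHA. A frame has $n$ slots and there are $m$ users. Each user independently draws a degree $d$ with probability $\lambda_d$ and transmits copies of its packet in a uniformly random set of $d$ distinct slots out of the $n$ slots. This gives a random (simple) bipartite graph $\mathcal G$ whose variable nodes (VNs) are the $m$ users and whose check nodes (CNs) are the $n$ slots, with an edge between a user and each slot in which it transmits. Decoding (successive interference cancellation): repeatedly, if some slot currently has degree exactly one, the unique user adjacent to it is declared resolved, and that user together with all its edges is removed from the graph; stop when no slot has degree one. Users never resolved are called unresolved. Stopping sets: a stopping set is a (nonempty) connected bipartite graph $\mathcal S$, with its two sides labelled as VNs and CNs, in which every CN has degree larger than one. Isomorphisms of such graphs map VNs to VNs and CNs to CNs. For a stopping set $\mathcal S$: $v_k(\mathcal S)$ is the number of VNs of degree $k$ in $\mathcal S$; $\nu(\mathcal S)$ is the total number of VNs; $\mu(\mathcal S)$ is the total number of CNs. The number $c(\mathcal S)$ is defined as follows: fix $\nu(\mathcal S)$ distinguishable VNs with prescribed degrees, exactly $v_k(\mathcal S)$ of them having degree $k$ for each $k$, and $\mu(\mathcal S)$ distinguishable CNs; $c(\mathcal S)$ is the number of simple bipartite graphs on these labelled nodes in which each VN has its prescribed degree and which are isomorphic to $\mathcal S$. *)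

theory Defs
  imports "HOL-Probability.Product_PMF" "HOL-Analysis.Analysis"
begin

section \<open>Bipartite graphs with a variable-node side and a check-node side\<close>

record ('v, 'c) bgraph =
  VN :: "'v set"
  CN :: "'c set"
  edges :: "('v \<times> 'c) set"

definition fin_bgraph :: "('v, 'c) bgraph \<Rightarrow> bool" where
  "fin_bgraph G \<longleftrightarrow> finite (VN G) \<and> finite (CN G) \<and> edges G \<subseteq> VN G \<times> CN G"

definition vdeg :: "('v, 'c) bgraph \<Rightarrow> 'v \<Rightarrow> nat" where
  "vdeg G v = card {c. (v, c) \<in> edges G}"

definition cdeg :: "('v, 'c) bgraph \<Rightarrow> 'c \<Rightarrow> nat" where
  "cdeg G c = card {v. (v, c) \<in> edges G}"

definition nodes :: "('v, 'c) bgraph \<Rightarrow> ('v + 'c) set" where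
  "nodes G = VN G <+> CN G"

definition adjacent :: "('v, 'c) bgraph \<Rightarrow> (('v + 'c) \<times> ('v + 'c)) set" where
  "adjacent G = (let A = {(Inl v, Inr c) | v c. (v, c) \<in> edges G} in A \<union> A\<inverse>)"

definition connected_bgraph :: "('v, 'c) bgraph \<Rightarrow> bool" where
  "connected_bgraph G \<longleftrightarrow> (\<forall>x\<in>nodes G. \<forall>y\<in>nodes G. (x, y) \<in> (adjacent G)\<^sup>*)"

definition bgraph_iso :: "('v, 'c) bgraph \<Rightarrow> ('w, 'd) bgraph \<Rightarrow> bool" where
  "bgraph_iso G H \<longleftrightarrow> (\<exists>f g. bij_betw f (VN G) (VN H) \<and> bij_betw g (CN G) (CN H) \<and>
     (\<forall>v\<in>VN G. \<forall>c\<in>CN G. (v, c) \<in> edges G \<longleftrightarrow> (f v, g c) \<in> edges H))"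


section \<open>Coded slotted ALOHA\<close>

text \<open>For \<open>d \<le> n\<close> the set below is finite and nonempty, so \<open>pmf_of_set\<close> is the uniform
  distribution on it; for \<open>d > n\<close> the value is irrelevant when \<open>lam\<close> is supported on
  degrees \<open>\<le> n\<close>.\<close>

definition user_pmf :: "nat \<Rightarrow> nat pmf \<Rightarrow> nat set pmf" where
  "user_pmf n lam = do { d \<leftarrow> lam; pmf_of_set {T. T \<subseteq> {..<n} \<and> card T = d} }"

definition transmission_graph :: "nat \<Rightarrow> nat \<Rightarrow> (nat \<Rightarrow> nat set) \<Rightarrow> (nat, nat) bgraph" where
  "transmission_graph m n T =
     \<lparr>VN = {..<m}, CN = {..<n}, edges = {(u, s). u < m \<and> s < n \<and> s \<in> T u}\<rparr>"

definition csa_graph :: "nat \<Rightarrow> nat \<Rightarrow> nat pmf \<Rightarrow> (nat, nat) bgraph pmf" where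
  "csa_graph m n lam =
     map_pmf (transmission_graph m n) (Pi_pmf {..<m} {} (\<lambda>_. user_pmf n lam))"


section \<open>Successive interference cancellation\<close>

definition remove_VN :: "'v \<Rightarrow> ('v, 'c) bgraph \<Rightarrow> ('v, 'c) bgraph" where
  "remove_VN v G = \<lparr>VN = VN G - {v}, CN = CN G, edges = {e \<in> edges G. fst e \<noteq> v}\<rparr>"

inductive sic_step :: "('v, 'c) bgraph \<Rightarrow> ('v, 'c) bgraph \<Rightarrow> bool" where
  "c \<in> CN G \<Longrightarrow> cdeg G c = 1 \<Longrightarrow> (v, c) \<in> edges G \<Longrightarrow> sic_step G (remove_VN v G)"

definition sic_final :: "('v, 'c) bgraph \<Rightarrow> ('v, 'c) bgraph \<Rightarrow> bool" where
  "sic_final G H \<longleftrightarrow> sic_step\<^sup>*\<^sup>* G H \<and> (\<forall>c\<in>CN H. cdeg H c \<noteq> 1)"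

text \<open>The final graph does not depend on the order in which slots are processed; see
  \<open>ex1_sic_final\<close> below.\<close>

definition sic_residual :: "('v, 'c) bgraph \<Rightarrow> ('v, 'c) bgraph" where
  "sic_residual G = (THE H. sic_final G H)"

definition unresolved :: "('v, 'c) bgraph \<Rightarrow> 'v set" where
  "unresolved G = VN (sic_residual G)"

definition expected_unresolved :: "nat \<Rightarrow> nat \<Rightarrow> nat pmf \<Rightarrow> nat \<Rightarrow> real" where
  "expected_unresolved m n lam d =
     measure_pmf.expectation (csa_graph m n lam)
       (\<lambda>G. real (card {u \<in> unresolved G. vdeg G u = d}))"


section \<open>Stopping sets\<close>

definition stopping_set :: "('v, 'c) bgraph \<Rightarrow> bool" where
  "stopping_set S \<longleftrightarrow> fin_bgraph S \<and> nodes S \<noteq> {} \<and> connected_bgraph S \<and>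
     (\<forall>c\<in>CN S. cdeg S c > 1)"

definition v_num :: "nat \<Rightarrow> ('v, 'c) bgraph \<Rightarrow> nat" where
  "v_num k S = card {v \<in> VN S. vdeg S v = k}"

definition \<nu> :: "('v, 'c) bgraph \<Rightarrow> nat" where
  "\<nu> S = card (VN S)"

definition \<mu> :: "('v, 'c) bgraph \<Rightarrow> nat" where
  "\<mu> S = card (CN S)"

definition labelled_copies ::
    "'w set \<Rightarrow> 'd set \<Rightarrow> ('w \<Rightarrow> nat) \<Rightarrow> ('v, 'c) bgraph \<Rightarrow> ('w, 'd) bgraph set" where
  "labelled_copies V C \<delta> S =
     {H. fin_bgraph H \<and> VN H = V \<and> CN H = C \<and> (\<forall>v\<in>V. vdeg H v = \<delta> v) \<and> bgraph_iso H S}"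

text \<open>The labelled nodes are taken to be those of \<open>S\<close>, the prescribed degrees those in \<open>S\<close>.
  Any other labelled nodes and prescribed degrees with the same numbers of nodes of each kind
  give the same count; see \<open>card_labelled_copies\<close> below.\<close>

definition c_num :: "('v, 'c) bgraph \<Rightarrow> nat" where
  "c_num S = card (labelled_copies (VN S) (CN S) (vdeg S) S)"

definition stopping_sets :: "nat \<Rightarrow> nat \<Rightarrow> nat \<Rightarrow> (nat, nat) bgraph set" where
  "stopping_sets q m n = {S. stopping_set S \<and> \<nu> S \<le> m \<and> (\<forall>v\<in>VN S. vdeg S v \<le> q) \<and> \<mu> S \<le> n}"

definition iso_rel :: "((nat, nat) bgraph \<times> (nat, nat) bgraph) set" where
  "iso_rel = {(S, T). fin_bgraph S \<and> fin_bgraph T \<and> bgraph_iso S T}"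

text \<open>Every finite bipartite graph is isomorphic to one with natural numbers as nodes, so the
  isomorphism classes are those of graphs of this type.\<close>

definition stopping_classes :: "nat \<Rightarrow> nat \<Rightarrow> nat \<Rightarrow> (nat, nat) bgraph set set" where
  "stopping_classes q m n = stopping_sets q m n // iso_rel"

definition class_rep :: "'a set \<Rightarrow> 'a" where
  "class_rep X = (SOME S. S \<in> X)"

definition \<alpha> :: "nat \<Rightarrow> nat \<Rightarrow> nat pmf \<Rightarrow> ('v, 'c) bgraph \<Rightarrow> real" where
  "\<alpha> q m lam S =
     fact m / fact (m - \<nu> S) * (\<Prod>k=1..q. pmf lam k ^ v_num k S / fact (v_num k S))"

definition \<beta> :: "nat \<Rightarrow> ('v, 'c) bgraph \<Rightarrow> real" where
  "\<beta> n S = real (n choose \<mu> S)"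

definition \<gamma> :: "nat \<Rightarrow> nat \<Rightarrow> ('v, 'c) bgraph \<Rightarrow> real" where
  "\<gamma> q n S = real (c_num S) / (\<Prod>k=1..q. real (n choose k) ^ v_num k S)"


section \<open>Well-definedness\<close>

subsection \<open>The residual graph of the decoder\<close>

definition restrict_VN :: "('v, 'c) bgraph \<Rightarrow> 'v set \<Rightarrow> ('v, 'c) bgraph" where
  "restrict_VN G W = \<lparr>VN = W, CN = CN G, edges = {e \<in> edges G. fst e \<in> W}\<rparr>"

lemma sic_step_fin_bgraph:
  assumes "sic_step G H" "fin_bgraph G"
  shows "fin_bgraph H" "card (VN H) < card (VN G)"
proof -
  from assms obtain c v where cv: "(v, c) \<in> edges G" and H: "H = remove_VN v G"
    by (auto elim: sic_step.cases)
  show "fin_bgraph H"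
    using assms(2) by (auto simp: H remove_VN_def fin_bgraph_def)
  have "v \<in> VN G" "finite (VN G)"
    using cv assms(2) by (auto simp: fin_bgraph_def)
  then show "card (VN H) < card (VN G)"
    unfolding H remove_VN_def by (simp only: bgraph.select_convs card_Diff1_less)
qed

lemma ex_sic_final: "fin_bgraph G \<Longrightarrow> \<exists>H. sic_final G H"
proof (induction "card (VN G)" arbitrary: G rule: less_induct)
  case less
  show ?case
  proof (cases "\<exists>G'. sic_step G G'")
    case True
    then obtain G' where G': "sic_step G G'" by blast
    obtain H where "sic_final G' H"
      using less.hyps[of G'] sic_step_fin_bgraph[OF G' less.prems] by blast
    with G' show ?thesis
      unfolding sic_final_def by (meson converse_rtranclp_into_rtranclp)
  next
    case False
    have "cdeg G c \<noteq> 1" if "c \<in> CN G" for c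
    proof
      assume d: "cdeg G c = 1"
      then obtain v where "{v. (v, c) \<in> edges G} = {v}"
        unfolding cdeg_def by (auto simp: card_Suc_eq)
      then have "(v, c) \<in> edges G" by blast
      with d that False show False by (meson sic_step.intros)
    qed
    then show ?thesis unfolding sic_final_def by blast
  qed
qed

lemma sic_steps_restrict:
  "sic_step\<^sup>*\<^sup>* G H \<Longrightarrow> fin_bgraph G \<Longrightarrow> VN H \<subseteq> VN G \<and> H = restrict_VN G (VN H)"
proof (induction rule: rtranclp_induct)
  case base
  then show ?case
    by (cases G) (auto simp: restrict_VN_def fin_bgraph_def)
next
  case (step H K)
  then obtain v where K: "K = remove_VN v H"
    by (auto elim: sic_step.cases)
  have IH: "VN H \<subseteq> VN G" and "H = restrict_VN G (VN H)"
    using step.IH[OF step.prems] by blast+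
  then have "CN H = CN G" "edges H = {e \<in> edges G. fst e \<in> VN H}"
    by (metis restrict_VN_def bgraph.select_convs)+
  with IH show ?case
    by (auto simp: K remove_VN_def restrict_VN_def)
qed

lemma sic_steps_keep:
  assumes "sic_step\<^sup>*\<^sup>* G H" "fin_bgraph G"
    and W: "W \<subseteq> VN G" "\<forall>c\<in>CN G. cdeg (restrict_VN G W) c \<noteq> 1"
  shows "W \<subseteq> VN H"
  using assms(1)
proof (induction rule: rtranclp_induct)
  case base
  show ?case by (rule W)
next
  case (step H K)
  from step.hyps(2) obtain c v where c: "c \<in> CN H" "cdeg H c = 1" "(v, c) \<in> edges H"
    and K: "K = remove_VN v H"
    by (auto elim: sic_step.cases)
  have "H = restrict_VN G (VN H)"
    using sic_steps_restrict[OF step.hyps(1) assms(2)] by simp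
  then have CH: "CN H = CN G" and EH: "edges H = {e \<in> edges G. fst e \<in> VN H}"
    by (metis restrict_VN_def bgraph.select_convs)+
  have "v \<notin> W"
  proof
    assume "v \<in> W"
    from c obtain v' where v': "{v. (v, c) \<in> edges H} = {v'}"
      unfolding cdeg_def by (auto simp: card_Suc_eq)
    then have "v' = v" using c(3) by auto
    with v' \<open>v \<in> W\<close> step.IH c(3) EH
    have "{x. (x, c) \<in> edges (restrict_VN G W)} = {v}"
      by (auto simp: restrict_VN_def)
    then have "cdeg (restrict_VN G W) c = 1" by (simp add: cdeg_def)
    with W(2) c(1) CH show False by auto
  qed
  with step.IH show ?case by (auto simp: K remove_VN_def)
qed

theorem ex1_sic_final:
  assumes "fin_bgraph G"
  shows "\<exists>!H. sic_final G H"
proof (rule ex_ex1I[OF ex_sic_final[OF assms]])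
  have sub: "VN H \<subseteq> VN K" if "sic_final G H" "sic_final G K" for H K
  proof (rule sic_steps_keep[OF _ assms])
    show "sic_step\<^sup>*\<^sup>* G K" using that by (simp add: sic_final_def)
    have H: "VN H \<subseteq> VN G \<and> H = restrict_VN G (VN H)"
      using that sic_steps_restrict[OF _ assms] by (simp add: sic_final_def)
    then show "VN H \<subseteq> VN G" by blast
    have "CN H = CN G" using H by (metis restrict_VN_def bgraph.select_convs(2))
    then show "\<forall>c\<in>CN G. cdeg (restrict_VN G (VN H)) c \<noteq> 1"
      using that(1) H unfolding sic_final_def by metis
  qed
  fix H K assume *: "sic_final G H" "sic_final G K"
  then have "VN H = VN K" using sub by blast
  moreover have "H = restrict_VN G (VN H)" "K = restrict_VN G (VN K)"
    using * sic_steps_restrict[OF _ assms] by (auto simp: sic_final_def)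
  ultimately show "H = K" by simp
qed

subsection \<open>Isomorphism classes\<close>

lemma bgraph_iso_refl: "bgraph_iso G G"
  unfolding bgraph_iso_def by (rule exI[of _ id], rule exI[of _ id]) auto

lemma bgraph_iso_sym:
  assumes "bgraph_iso G H"
  shows "bgraph_iso H G"
proof -
  obtain f g where f: "bij_betw f (VN G) (VN H)" and g: "bij_betw g (CN G) (CN H)"
    and e: "\<forall>v\<in>VN G. \<forall>c\<in>CN G. (v, c) \<in> edges G \<longleftrightarrow> (f v, g c) \<in> edges H"
    using assms unfolding bgraph_iso_def by blast
  let ?f = "inv_into (VN G) f" and ?g = "inv_into (CN G) g"
  have "\<forall>v\<in>VN H. \<forall>c\<in>CN H. (v, c) \<in> edges H \<longleftrightarrow> (?f v, ?g c) \<in> edges G"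
  proof (intro ballI)
    fix v c assume vc: "v \<in> VN H" "c \<in> CN H"
    then have "?f v \<in> VN G" "?g c \<in> CN G"
      using f g by (meson bij_betw_apply bij_betw_inv_into)+
    moreover have "f (?f v) = v" "g (?g c) = c"
      using f g vc by (simp_all add: bij_betw_inv_into_right)
    ultimately show "(v, c) \<in> edges H \<longleftrightarrow> (?f v, ?g c) \<in> edges G"
      using e by metis
  qed
  then show ?thesis
    unfolding bgraph_iso_def using bij_betw_inv_into[OF f] bij_betw_inv_into[OF g] by blast
qed

lemma bgraph_iso_trans:
  assumes "bgraph_iso G H" "bgraph_iso H K"
  shows "bgraph_iso G K"
proof -
  obtain f g where f: "bij_betw f (VN G) (VN H)" and g: "bij_betw g (CN G) (CN H)"
    and e: "\<forall>v\<in>VN G. \<forall>c\<in>CN G. (v, c) \<in> edges G \<longleftrightarrow> (f v, g c) \<in> edges H"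
    using assms(1) unfolding bgraph_iso_def by blast
  obtain f' g' where f': "bij_betw f' (VN H) (VN K)" and g': "bij_betw g' (CN H) (CN K)"
    and e': "\<forall>v\<in>VN H. \<forall>c\<in>CN H. (v, c) \<in> edges H \<longleftrightarrow> (f' v, g' c) \<in> edges K"
    using assms(2) unfolding bgraph_iso_def by blast
  have "\<forall>v\<in>VN G. \<forall>c\<in>CN G. (v, c) \<in> edges G \<longleftrightarrow> ((f' \<circ> f) v, (g' \<circ> g) c) \<in> edges K"
    using e e' f g by (simp add: bij_betw_apply)
  then show ?thesis
    unfolding bgraph_iso_def using bij_betw_trans[OF f f'] bij_betw_trans[OF g g'] by blast
qed

lemma equiv_iso_rel: "equiv {S. fin_bgraph S} iso_rel"
  by (rule equivI)
    (auto simp: iso_rel_def refl_on_def sym_def trans_def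
          intro: bgraph_iso_refl bgraph_iso_sym bgraph_iso_trans)

lemma bij_vdeg:
  assumes "fin_bgraph G" "fin_bgraph H" "bij_betw g (CN G) (CN H)" "v \<in> VN G"
    and f: "bij_betw f (VN G) (VN H)"
    and e: "\<forall>v\<in>VN G. \<forall>c\<in>CN G. (v, c) \<in> edges G \<longleftrightarrow> (f v, g c) \<in> edges H"
  shows "vdeg H (f v) = vdeg G v"
proof -
  have "bij_betw g {c. (v, c) \<in> edges G} {c. (f v, c) \<in> edges H}"
    unfolding bij_betw_def
  proof
    show "inj_on g {c. (v, c) \<in> edges G}"
      using assms(1,3) by (auto simp: fin_bgraph_def bij_betw_def intro: inj_on_subset)
    show "g ` {c. (v, c) \<in> edges G} = {c. (f v, c) \<in> edges H}"
    proof
      show "g ` {c. (v, c) \<in> edges G} \<subseteq> {c. (f v, c) \<in> edges H}"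
        using assms(1) e by (auto simp: fin_bgraph_def)
      show "{c. (f v, c) \<in> edges H} \<subseteq> g ` {c. (v, c) \<in> edges G}"
      proof
        fix d assume d: "d \<in> {c. (f v, c) \<in> edges H}"
        then have "d \<in> CN H" using assms(2) by (auto simp: fin_bgraph_def)
        then obtain c where "c \<in> CN G" "d = g c"
          using assms(3) by (auto simp: bij_betw_def)
        with d e assms(4) show "d \<in> g ` {c. (v, c) \<in> edges G}" by auto
      qed
    qed
  qed
  then show ?thesis unfolding vdeg_def by (metis bij_betw_same_card)
qed

lemma bij_betw_subset_cond:
  assumes "bij_betw f A B" "\<And>a. a \<in> A \<Longrightarrow> Q (f a) \<longleftrightarrow> P a"
  shows "bij_betw f {a \<in> A. P a} {b \<in> B. Q b}"
proof -
  have "f ` {a \<in> A. P a} = {b \<in> f ` A. Q b}"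
    using assms(2) by blast
  moreover have "inj_on f {a \<in> A. P a}"
    using assms(1) unfolding bij_betw_def inj_on_def by blast
  moreover have "f ` A = B"
    using assms(1) by (simp add: bij_betw_def)
  ultimately show ?thesis by (simp add: bij_betw_def)
qed

lemma iso_invariant:
  assumes "fin_bgraph G" "fin_bgraph H" "bgraph_iso G H"
  shows "v_num k G = v_num k H" "\<nu> G = \<nu> H" "\<mu> G = \<mu> H"
proof -
  obtain f g where f: "bij_betw f (VN G) (VN H)" and g: "bij_betw g (CN G) (CN H)"
    and e: "\<forall>v\<in>VN G. \<forall>c\<in>CN G. (v, c) \<in> edges G \<longleftrightarrow> (f v, g c) \<in> edges H"
    using assms(3) unfolding bgraph_iso_def by blast
  have d: "vdeg H (f v) = vdeg G v" if "v \<in> VN G" for v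
    using bij_vdeg[OF assms(1,2) g that f e] .
  have "bij_betw f {v \<in> VN G. vdeg G v = k} {v \<in> VN H. vdeg H v = k}"
    using d by (intro bij_betw_subset_cond[OF f]) auto
  then show "v_num k G = v_num k H" unfolding v_num_def by (rule bij_betw_same_card)
  show "\<nu> G = \<nu> H" "\<mu> G = \<mu> H"
    unfolding \<nu>_def \<mu>_def using f g by (auto dest: bij_betw_same_card)
qed

definition map_bgraph :: "('v \<Rightarrow> 'w) \<Rightarrow> ('c \<Rightarrow> 'd) \<Rightarrow> ('v, 'c) bgraph \<Rightarrow> ('w, 'd) bgraph" where
  "map_bgraph f g G = \<lparr>VN = f ` VN G, CN = g ` CN G, edges = map_prod f g ` edges G\<rparr>"

lemma map_bgraph_iso:
  assumes "fin_bgraph G" "inj_on f (VN G)" "inj_on g (CN G)"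
  shows "fin_bgraph (map_bgraph f g G)" "bgraph_iso G (map_bgraph f g G)"
    and "v \<in> VN G \<Longrightarrow> vdeg (map_bgraph f g G) (f v) = vdeg G v"
proof -
  show 1: "fin_bgraph (map_bgraph f g G)"
    using assms(1) by (auto simp: map_bgraph_def fin_bgraph_def)
  have f: "bij_betw f (VN G) (VN (map_bgraph f g G))"
    and g: "bij_betw g (CN G) (CN (map_bgraph f g G))"
    using assms by (auto simp: map_bgraph_def bij_betw_def)
  have e: "\<forall>v\<in>VN G. \<forall>c\<in>CN G. (v, c) \<in> edges G \<longleftrightarrow> (f v, g c) \<in> edges (map_bgraph f g G)"
  proof (intro ballI iffI)
    fix v c assume "(v, c) \<in> edges G"
    then show "(f v, g c) \<in> edges (map_bgraph f g G)"
      unfolding map_bgraph_def by force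
  next
    fix v c assume vc: "v \<in> VN G" "c \<in> CN G" "(f v, g c) \<in> edges (map_bgraph f g G)"
    then obtain v' c' where *: "(v', c') \<in> edges G" "f v = f v'" "g c = g c'"
      by (auto simp: map_bgraph_def)
    then have "v' \<in> VN G" "c' \<in> CN G" using assms(1) by (auto simp: fin_bgraph_def)
    with * vc assms(2,3) have "v = v'" "c = c'" by (auto dest: inj_onD)
    with * show "(v, c) \<in> edges G" by simp
  qed
  show "bgraph_iso G (map_bgraph f g G)"
    unfolding bgraph_iso_def using f g e by blast
  show "v \<in> VN G \<Longrightarrow> vdeg (map_bgraph f g G) (f v) = vdeg G v"
    by (rule bij_vdeg[OF assms(1) 1 g _ f e])
qed

lemma map_bgraph_comp: "map_bgraph f' g' (map_bgraph f g G) = map_bgraph (f' \<circ> f) (g' \<circ> g) G"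
  by (simp add: map_bgraph_def image_comp map_prod_compose)

lemma map_bgraph_ident:
  assumes "fin_bgraph G" "\<And>v. v \<in> VN G \<Longrightarrow> f v = v" "\<And>c. c \<in> CN G \<Longrightarrow> g c = c"
  shows "map_bgraph f g G = G"
proof -
  have "map_prod f g ` edges G = id ` edges G"
    using assms by (intro image_cong) (auto simp: fin_bgraph_def)
  moreover have "f ` VN G = id ` VN G" "g ` CN G = id ` CN G"
    using assms by (auto intro!: image_cong)
  ultimately show ?thesis by (simp add: map_bgraph_def)
qed

lemma card_labelled_copies:
  fixes S :: "('v, 'c) bgraph" and V :: "'w set" and C :: "'d set"
  assumes S: "fin_bgraph S" and V: "finite V" and C: "finite C" "card C = \<mu> S"
    and \<delta>: "\<And>k. card {v \<in> V. \<delta> v = k} = v_num k S"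
  shows "card (labelled_copies V C \<delta> S) = c_num S"
proof -
  have "\<exists>h. bij_betw h {v \<in> V. \<delta> v = k} {v \<in> VN S. vdeg S v = k}" for k
    using S V \<delta>[of k] by (intro finite_same_card_bij) (auto simp: fin_bgraph_def v_num_def)
  then obtain h where h: "\<And>k. bij_betw (h k) {v \<in> V. \<delta> v = k} {v \<in> VN S. vdeg S v = k}"
    by metis
  define f where "f v = h (\<delta> v) v" for v
  have fd: "f v \<in> VN S \<and> vdeg S (f v) = \<delta> v" if "v \<in> V" for v
    using h[of "\<delta> v"] that unfolding f_def bij_betw_def by blast
  have finj: "inj_on f V"
  proof (rule inj_onI)
    fix x y assume xy: "x \<in> V" "y \<in> V" "f x = f y"
    then have "\<delta> x = \<delta> y" using fd by metis
    with xy h[of "\<delta> x"] show "x = y"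
      unfolding f_def bij_betw_def by (auto dest: inj_onD)
  qed
  have fim: "f ` V = VN S"
  proof
    show "f ` V \<subseteq> VN S" using fd by blast
    show "VN S \<subseteq> f ` V"
    proof
      fix w assume "w \<in> VN S"
      then obtain v where "v \<in> V" "\<delta> v = vdeg S w" "h (vdeg S w) v = w"
        using h[of "vdeg S w"] unfolding bij_betw_def by force
      then show "w \<in> f ` V" by (force simp: f_def)
    qed
  qed
  obtain g where g: "bij_betw g C (CN S)"
    using finite_same_card_bij[of C "CN S"] C S by (auto simp: fin_bgraph_def \<mu>_def)
  have ginj: "inj_on g C" and gim: "g ` C = CN S" using g by (auto simp: bij_betw_def)
  define f' where "f' = inv_into V f"
  define g' where "g' = inv_into C g"
  have f'inj: "inj_on f' (VN S)" and f'im: "f' ` VN S = V"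
    using bij_betw_inv_into[of f V "VN S"] finj fim by (auto simp: f'_def bij_betw_def)
  have g'inj: "inj_on g' (CN S)" and g'im: "g' ` CN S = C"
    using bij_betw_inv_into[OF g] by (auto simp: g'_def bij_betw_def)
  have f'f: "f' (f v) = v" if "v \<in> V" for v using finj that by (simp add: f'_def)
  have ff': "f (f' v) = v" if "v \<in> VN S" for v using fim that by (simp add: f'_def f_inv_into_f)
  have g'g: "g' (g v) = v" if "v \<in> C" for v using ginj that by (simp add: g'_def)
  have gg': "g (g' v) = v" if "v \<in> CN S" for v using gim that by (simp add: g'_def f_inv_into_f)
  have "bij_betw (map_bgraph f g) (labelled_copies V C \<delta> S)
          (labelled_copies (VN S) (CN S) (vdeg S) S)"
  proof (rule bij_betw_byWitness[where f' = "map_bgraph f' g'"])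
    show "\<forall>H\<in>labelled_copies V C \<delta> S. map_bgraph f' g' (map_bgraph f g H) = H"
      by (auto simp: labelled_copies_def map_bgraph_comp f'f g'g intro!: map_bgraph_ident)
    show "\<forall>H\<in>labelled_copies (VN S) (CN S) (vdeg S) S.
            map_bgraph f g (map_bgraph f' g' H) = H"
      by (auto simp: labelled_copies_def map_bgraph_comp ff' gg' intro!: map_bgraph_ident)
    show "map_bgraph f g ` labelled_copies V C \<delta> S \<subseteq> labelled_copies (VN S) (CN S) (vdeg S) S"
    proof (rule image_subsetI)
      fix H assume H: "H \<in> labelled_copies V C \<delta> S"
      then have *: "fin_bgraph H" "VN H = V" "CN H = C" "bgraph_iso H S"
        "\<And>v. v \<in> V \<Longrightarrow> vdeg H v = \<delta> v" by (auto simp: labelled_copies_def)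
      note m = map_bgraph_iso[of H f g, unfolded *(2,3), OF *(1) finj ginj]
      have "\<forall>w\<in>VN S. vdeg (map_bgraph f g H) w = vdeg S w"
        using m(3) *(5) fd fim by force
      moreover have "VN (map_bgraph f g H) = VN S" "CN (map_bgraph f g H) = CN S"
        using * fim gim by (auto simp: map_bgraph_def)
      ultimately show "map_bgraph f g H \<in> labelled_copies (VN S) (CN S) (vdeg S) S"
        using m(1) bgraph_iso_trans[OF bgraph_iso_sym[OF m(2)] *(4)]
        by (simp add: labelled_copies_def)
    qed
    show "map_bgraph f' g' ` labelled_copies (VN S) (CN S) (vdeg S) S \<subseteq> labelled_copies V C \<delta> S"
    proof (rule image_subsetI)
      fix H assume H: "H \<in> labelled_copies (VN S) (CN S) (vdeg S) S"
      then have *: "fin_bgraph H" "VN H = VN S" "CN H = CN S" "bgraph_iso H S"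
        "\<And>v. v \<in> VN S \<Longrightarrow> vdeg H v = vdeg S v" by (auto simp: labelled_copies_def)
      note m = map_bgraph_iso[of H f' g', unfolded *(2,3), OF *(1) f'inj g'inj]
      have "\<forall>v\<in>V. vdeg (map_bgraph f' g' H) v = \<delta> v"
        using m(3) *(5) fd f'f by metis
      moreover have "VN (map_bgraph f' g' H) = V" "CN (map_bgraph f' g' H) = C"
        using * f'im g'im by (auto simp: map_bgraph_def)
      ultimately show "map_bgraph f' g' H \<in> labelled_copies V C \<delta> S"
        using m(1) bgraph_iso_trans[OF bgraph_iso_sym[OF m(2)] *(4)]
        by (simp add: labelled_copies_def)
    qed
  qed
  then show ?thesis unfolding c_num_def by (rule bij_betw_same_card)
qed

lemma c_num_iso:
  assumes "fin_bgraph G" "fin_bgraph H" "bgraph_iso G H"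
  shows "c_num G = c_num H"
proof -
  have "labelled_copies V C \<delta> G = labelled_copies V C \<delta> H" for V :: "'c set" and C :: "'d set" and \<delta>
    using assms(3) unfolding labelled_copies_def
    by (auto intro: bgraph_iso_trans bgraph_iso_sym)
  moreover have "card (labelled_copies (VN H) (CN H) (vdeg H) G) = c_num G"
    using assms iso_invariant[OF assms]
    by (intro card_labelled_copies) (auto simp: fin_bgraph_def \<mu>_def v_num_def)
  ultimately show ?thesis by (simp add: c_num_def)
qed

lemma finite_stopping_classes: "finite (stopping_classes q m n)"
proof -
  define F where "F = {S :: (nat, nat) bgraph. VN S \<subseteq> {..<m} \<and> CN S \<subseteq> {..<n} \<and>
    edges S \<subseteq> {..<m} \<times> {..<n}}"
  have "F \<subseteq> (\<lambda>(V, C, E). \<lparr>VN = V, CN = C, edges = E\<rparr>) `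
      (Pow {..<m} \<times> Pow {..<n} \<times> Pow ({..<m} \<times> {..<n}))"
  proof
    fix S assume "S \<in> F"
    then show "S \<in> (\<lambda>(V, C, E). \<lparr>VN = V, CN = C, edges = E\<rparr>) `
        (Pow {..<m} \<times> Pow {..<n} \<times> Pow ({..<m} \<times> {..<n}))"
      by (intro image_eqI[where x = "(VN S, CN S, edges S)"]) (auto simp: F_def)
  qed
  then have finF: "finite F" by (rule finite_subset) auto
  have "stopping_classes q m n \<subseteq> (\<lambda>S. iso_rel `` {S}) ` F"
  proof
    fix X assume "X \<in> stopping_classes q m n"
    then obtain S where S: "S \<in> stopping_sets q m n" and X: "X = iso_rel `` {S}"
      unfolding stopping_classes_def by (auto elim: quotientE)
    then have fin: "fin_bgraph S" "card (VN S) \<le> m" "card (CN S) \<le> n"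
      by (auto simp: stopping_sets_def stopping_set_def \<nu>_def \<mu>_def)
    obtain f where f: "bij_betw f (VN S) {..<card (VN S)}"
      using ex_bij_betw_finite_nat[of "VN S"] fin by (auto simp: fin_bgraph_def atLeast0LessThan)
    obtain g where g: "bij_betw g (CN S) {..<card (CN S)}"
      using ex_bij_betw_finite_nat[of "CN S"] fin by (auto simp: fin_bgraph_def atLeast0LessThan)
    have m: "fin_bgraph (map_bgraph f g S)" "bgraph_iso S (map_bgraph f g S)"
      using map_bgraph_iso[OF fin(1), of f g] f g by (auto simp: bij_betw_def)
    have "(S, map_bgraph f g S) \<in> iso_rel" using fin m by (simp add: iso_rel_def)
    then have "X = iso_rel `` {map_bgraph f g S}"
      unfolding X by (rule equiv_class_eq[OF equiv_iso_rel])
    moreover have "VN (map_bgraph f g S) \<subseteq> {..<m}" "CN (map_bgraph f g S) \<subseteq> {..<n}"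
      using f g fin by (auto simp: map_bgraph_def bij_betw_def)
    moreover from this have "edges (map_bgraph f g S) \<subseteq> {..<m} \<times> {..<n}"
      using m(1) unfolding fin_bgraph_def by blast
    ultimately show "X \<in> (\<lambda>S. iso_rel `` {S}) ` F" by (auto simp: F_def)
  qed
  then show ?thesis using finF by (meson finite_imageI finite_subset)
qed

lemma class_rep_stopping_classes:
  assumes "S \<in> stopping_sets q m n"
  shows "(S, class_rep (iso_rel `` {S})) \<in> iso_rel"
proof -
  have "S \<in> iso_rel `` {S}"
    using assms bgraph_iso_refl[of S]
    by (auto simp: iso_rel_def stopping_sets_def stopping_set_def)
  then have "class_rep (iso_rel `` {S}) \<in> iso_rel `` {S}"
    unfolding class_rep_def by (rule someI)
  then show ?thesis by simp
qed

lemma summand_iso_invariant: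
  assumes "(S, T) \<in> iso_rel"
  shows "real (v_num d S) * \<alpha> q m lam S * \<beta> n S * \<gamma> q n S =
         real (v_num d T) * \<alpha> q m lam T * \<beta> n T * \<gamma> q n T"
proof -
  have *: "fin_bgraph S" "fin_bgraph T" "bgraph_iso S T"
    using assms by (simp_all add: iso_rel_def)
  show ?thesis
    by (simp only: \<alpha>_def \<beta>_def \<gamma>_def iso_invariant[OF *] c_num_iso[OF *])
qed

end

theory Submission
  imports Defs "HOL-Combinatorics.Multiset_Permutations"
begin

text \<open>An unresolved user lies in a connected component of the residual graph; this component is
  a stopping set on some users \<open>V\<close> and slots \<open>C\<close> in which every user of \<open>V\<close> keeps all its edges.
  Hence, pointwise, the number of unresolved users of degree \<open>d\<close> is at most the sum of
  \<open>v_num d H\<close> over all labelled stopping sets \<open>H\<close> such that the users of \<open>H\<close> transmit exactly in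
  their slots of \<open>H\<close>. Such an \<open>H\<close> occurs with probability
  \<open>\<Prod>k. (\<lambda>\<^sub>k / (n choose k)) ^ v_num k H\<close>, and an isomorphism class of a stopping set \<open>S\<close> has at most
  \<open>(m choose \<nu> S) * (n choose \<mu> S) * (\<nu> S)! / (\<Prod>k. (v_num k S)!) * c_num S\<close> labelled members:
  choose the users, the slots, the degrees of the users, and the edges.\<close>

section \<open>The distribution of the transmission sets\<close>

lemma set_user_pmf:
  assumes "set_pmf lam \<subseteq> {0..q}" "q \<le> n"
  shows "set_pmf (user_pmf n lam) \<subseteq> {T. T \<subseteq> {..<n} \<and> card T \<le> q}"
proof
  fix T assume "T \<in> set_pmf (user_pmf n lam)"
  then obtain k where k: "k \<in> set_pmf lam" "T \<in> set_pmf (pmf_of_set {T. T \<subseteq> {..<n} \<and> card T = k})"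
    by (auto simp: user_pmf_def)
  then have kq: "k \<le> q" using assms by auto
  have fin: "finite {T. T \<subseteq> {..<n} \<and> card T = k}" by simp
  have "{..<k} \<in> {T. T \<subseteq> {..<n} \<and> card T = k}" using kq assms by auto
  then have "{T. T \<subseteq> {..<n} \<and> card T = k} \<noteq> {}" by blast
  from set_pmf_of_set[OF this fin] k kq
  show "T \<in> {T. T \<subseteq> {..<n} \<and> card T \<le> q}" by auto
qed

text \<open>A given set \<open>T\<close> can arise only from the degree \<open>card T\<close>, so
  the mixture over degrees collapses to one term. Support in \<open>{0..n}\<close> keeps every
  uniform choice on a nonempty family.\<close>

lemma pmf_user_pmf:
  assumes "set_pmf lam \<subseteq> {0..n}" "T \<subseteq> {..<n}"
  shows "pmf (user_pmf n lam) T = pmf lam (card T) / real (n choose card T)"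
proof -
  have *: "pmf (pmf_of_set {T. T \<subseteq> {..<n} \<and> card T = k}) T =
      (if k = card T then 1 / real (n choose k) else 0)" if "k \<in> {0..n}" for k
  proof -
    have card: "card {T. T \<subseteq> {..<n} \<and> card T = k} = n choose k"
      using n_subsets[of "{..<n}" k] by simp
    have "{..<k} \<in> {T. T \<subseteq> {..<n} \<and> card T = k}" using that by auto
    then have "{T. T \<subseteq> {..<n} \<and> card T = k} \<noteq> {}" by blast
    then show ?thesis
      using assms(2) by (subst pmf_of_set) (auto simp: card indicator_def)
  qed
  have "card T \<in> {0..n}"
    using card_mono[OF _ assms(2)] by simp
  have "pmf (user_pmf n lam) T =
      (\<Sum>k\<in>{0..n}. pmf (pmf_of_set {T. T \<subseteq> {..<n} \<and> card T = k}) T * pmf lam k)"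
    unfolding user_pmf_def pmf_bind using assms(1)
    by (intro integral_measure_pmf_real) auto
  also have "\<dots> = (\<Sum>k\<in>{0..n}. if k = card T then pmf lam (card T) / real (n choose card T) else 0)"
    using * by (intro sum.cong) auto
  also have "\<dots> = pmf lam (card T) / real (n choose card T)"
    using \<open>card T \<in> {0..n}\<close> by (subst sum.delta) auto
  finally show ?thesis .
qed

lemma prob_Pi_pmf_agree:
  assumes "finite A" "V \<subseteq> A"
  shows "measure_pmf.prob (Pi_pmf A dflt p) {T. \<forall>v\<in>V. T v = x v} = (\<Prod>v\<in>V. pmf (p v) (x v))"
proof -
  \<comment> \<open>\<open>UNIV\<close> at the coordinates outside \<open>V\<close> turns agreement
    on \<open>V\<close> into a product event; those factors have probability 1.\<close>
  define B where "B v = (if v \<in> V then {x v} else UNIV)" for v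
  have "{T. \<forall>v\<in>V. T v = x v} = Pi A B"
    using assms(2) by (auto simp: B_def Pi_def split: if_splits)
  then have "measure_pmf.prob (Pi_pmf A dflt p) {T. \<forall>v\<in>V. T v = x v} =
      (\<Prod>v\<in>A. measure_pmf.prob (p v) (B v))"
    using assms(1) by (simp add: measure_Pi_pmf_Pi)
  also have "\<dots> = (\<Prod>v\<in>V. measure_pmf.prob (p v) (B v))"
    using assms by (intro prod.mono_neutral_right) (auto simp: B_def)
  also have "\<dots> = (\<Prod>v\<in>V. pmf (p v) (x v))"
    by (intro prod.cong) (auto simp: B_def measure_pmf_single)
  finally show ?thesis .
qed

section \<open>Components of the residual graph\<close>

text \<open>Edges are selected by their VN end alone: an edge joins mutually reachable nodes, so its
  CN end is kept as well.\<close>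

definition component :: "('v, 'c) bgraph \<Rightarrow> 'v \<Rightarrow> ('v, 'c) bgraph" where
  "component R u = (let K = (adjacent R)\<^sup>* `` {Inl u} in
     \<lparr>VN = {v. Inl v \<in> K}, CN = {c. Inr c \<in> K}, edges = {e \<in> edges R. Inl (fst e) \<in> K}\<rparr>)"

lemma adjacent_iff [simp]:
  "(Inl v, Inr c) \<in> adjacent G \<longleftrightarrow> (v, c) \<in> edges G"
  "(Inr c, Inl v) \<in> adjacent G \<longleftrightarrow> (v, c) \<in> edges G"
  "(Inl v, Inl v') \<notin> adjacent G"
  "(Inr c, Inr c') \<notin> adjacent G"
  by (auto simp: adjacent_def Let_def)

lemma sym_adjacent: "sym (adjacent G)"
  by (auto simp: adjacent_def Let_def sym_def)

lemma component_sel: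
  "v \<in> VN (component R u) \<longleftrightarrow> (Inl u, Inl v) \<in> (adjacent R)\<^sup>*"
  "c \<in> CN (component R u) \<longleftrightarrow> (Inl u, Inr c) \<in> (adjacent R)\<^sup>*"
  "(v, c) \<in> edges (component R u) \<longleftrightarrow> (v, c) \<in> edges R \<and> v \<in> VN (component R u)"
  by (auto simp: component_def Let_def)

lemma component_edge_iff:
  assumes "(v, c) \<in> edges R"
  shows "v \<in> VN (component R u) \<longleftrightarrow> c \<in> CN (component R u)"
  unfolding component_sel using assms
  by (meson adjacent_iff(1,2) rtrancl.rtrancl_into_rtrancl)

text \<open>Every prefix of a path from \<open>u\<close> ends in the component, so the whole path
  survives there. Connectivity has to be shown for the component's own edges.\<close>

lemma component_reach:
  "(Inl u, x) \<in> (adjacent R)\<^sup>* \<Longrightarrow> (Inl u, x) \<in> (adjacent (component R u))\<^sup>*"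
proof (induction rule: rtrancl_induct)
  case (step x y)
  have "(x, y) \<in> adjacent (component R u)"
  proof (cases x)
    case (Inl v)
    with step.hyps(2) obtain c where "y = Inr c" "(v, c) \<in> edges R"
      by (cases y) auto
    with Inl step.hyps(1) show ?thesis by (simp add: component_sel)
  next
    case (Inr c)
    with step.hyps(2) obtain v where "y = Inl v" "(v, c) \<in> edges R"
      by (cases y) auto
    moreover from this Inr step.hyps(1) have "v \<in> VN (component R u)"
      by (simp add: component_edge_iff component_sel(2))
    ultimately show ?thesis using Inr by (simp add: component_sel(3))
  qed
  with step.IH show ?case by simp
qed simp

lemma connected_component: "connected_bgraph (component R u)"
proof -
  have sym: "sym ((adjacent (component R u))\<^sup>*)"
    by (intro sym_rtrancl sym_adjacent)
  have reach: "(Inl u, x) \<in> (adjacent (component R u))\<^sup>*" if "x \<in> nodes (component R u)" for x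
    using that by (intro component_reach) (auto simp: nodes_def component_sel)
  show ?thesis
    unfolding connected_bgraph_def using reach sym
    by (meson rtrancl_trans symD)
qed

lemma component_subset:
  assumes "edges R \<subseteq> VN R \<times> CN R" "u \<in> VN R"
  shows "VN (component R u) \<subseteq> VN R" "CN (component R u) \<subseteq> CN R"
proof -
  have "x \<in> nodes R" if "(Inl u, x) \<in> (adjacent R)\<^sup>*" for x
    using that
  proof (induction rule: rtrancl_induct)
    case base
    then show ?case using assms by (auto simp: nodes_def)
  next
    case (step y z)
    then show ?case using assms by (cases y; cases z) (auto simp: nodes_def)
  qed
  then show "VN (component R u) \<subseteq> VN R" "CN (component R u) \<subseteq> CN R"
    by (force simp: nodes_def component_sel)+
qed

lemma cdeg_component:
  assumes "c \<in> CN (component R u)"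
  shows "cdeg (component R u) c = cdeg R c"
  unfolding cdeg_def using component_edge_iff[of _ c R u] assms
  by (intro arg_cong[where f = card]) (auto simp: component_sel(3))

text \<open>Since \<open>Inl u\<close> and \<open>Inr c\<close> differ, a path between them has a
  last step, which is an edge at \<open>c\<close>. This rules out slots of degree 0 in the
  component.\<close>

lemma component_check_has_edge:
  assumes "c \<in> CN (component R u)"
  shows "\<exists>v. (v, c) \<in> edges R"
proof -
  have "(Inl u, Inr c) \<in> (adjacent R)\<^sup>*" using assms by (simp add: component_sel)
  then obtain y where "(y, Inr c) \<in> adjacent R"
    by (cases rule: rtranclE) auto
  then show ?thesis by (cases y) auto
qed

text \<open>Slot degrees in the component equal those in \<open>R\<close>; they are not 1 by
  assumption and not 0 because the slot is reached from \<open>u\<close>.\<close>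

lemma stopping_set_component:
  assumes "fin_bgraph R" "u \<in> VN R" "\<And>c. c \<in> CN R \<Longrightarrow> cdeg R c \<noteq> 1"
  shows "stopping_set (component R u)"
proof -
  have R: "edges R \<subseteq> VN R \<times> CN R" "finite (VN R)" "finite (CN R)"
    using assms(1) by (auto simp: fin_bgraph_def)
  note sub = component_subset[OF R(1) assms(2)]
  have "fin_bgraph (component R u)"
    unfolding fin_bgraph_def
  proof (intro conjI subsetI)
    fix e assume "e \<in> edges (component R u)"
    then show "e \<in> VN (component R u) \<times> CN (component R u)"
      using component_edge_iff[of _ _ R u] by (cases e) (auto simp: component_sel(3))
  qed (use sub R finite_subset in blast)+
  moreover have "Inl u \<in> nodes (component R u)"
    by (auto simp: nodes_def component_sel)
  moreover have "cdeg (component R u) c > 1" if c: "c \<in> CN (component R u)" for c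
  proof -
    have "finite {v. (v, c) \<in> edges R}"
      using R by (auto intro: finite_subset[of _ "VN R"])
    moreover have "{v. (v, c) \<in> edges R} \<noteq> {}"
      using component_check_has_edge[OF c] by blast
    ultimately have "cdeg R c > 0" by (simp add: cdeg_def card_gt_0_iff)
    moreover have "cdeg R c \<noteq> 1" using assms(3) c sub by blast
    ultimately show ?thesis using cdeg_component[OF c] by simp
  qed
  ultimately show ?thesis
    unfolding stopping_set_def using connected_component[of R u] by auto
qed

section \<open>Unresolved users and their neighbourhoods\<close>

definition nbrs :: "('v, 'c) bgraph \<Rightarrow> 'v \<Rightarrow> 'c set" where
  "nbrs G v = {c. (v, c) \<in> edges G}"

lemma vdeg_eq_card_nbrs: "vdeg G v = card (nbrs G v)"
  by (simp add: vdeg_def nbrs_def)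

text \<open>Removing users leaves the remaining users with all their edges, so an unresolved user lies
  in a stopping set whose users have the same neighbours there as in the whole graph.\<close>

lemma unresolved_in_stopping_set:
  assumes G: "fin_bgraph G" and u: "u \<in> unresolved G"
  obtains H where "stopping_set H" "VN H \<subseteq> VN G" "CN H \<subseteq> CN G" "u \<in> VN H"
    "\<And>v. v \<in> VN H \<Longrightarrow> nbrs H v = nbrs G v"
proof -
  define R where "R = sic_residual G"
  have fin: "sic_final G R"
    unfolding R_def sic_residual_def by (rule theI'[OF ex1_sic_final[OF G]])
  then have steps: "sic_step\<^sup>*\<^sup>* G R" and nd: "\<And>c. c \<in> CN R \<Longrightarrow> cdeg R c \<noteq> 1"
    by (auto simp: sic_final_def)
  have VR: "VN R \<subseteq> VN G" and "R = restrict_VN G (VN R)"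
    using sic_steps_restrict[OF steps G] by blast+
  then have CR: "CN R = CN G" and ER: "edges R = {e \<in> edges G. fst e \<in> VN R}"
    by (metis restrict_VN_def bgraph.select_convs)+
  have finR: "fin_bgraph R"
    using G VR CR ER by (auto simp: fin_bgraph_def intro: finite_subset)
  have uR: "u \<in> VN R" using u by (simp add: unresolved_def R_def)
  have RR: "edges R \<subseteq> VN R \<times> CN R" using finR by (simp add: fin_bgraph_def)
  note sub = component_subset[OF RR uR]
  show ?thesis
  proof
    show "stopping_set (component R u)"
      by (rule stopping_set_component[OF finR uR nd])
    show "VN (component R u) \<subseteq> VN G" "CN (component R u) \<subseteq> CN G"
      using sub VR CR by auto
    show "u \<in> VN (component R u)" by (simp add: component_sel)
    show "nbrs (component R u) v = nbrs G v" if "v \<in> VN (component R u)" for v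
      using that sub ER by (auto simp: nbrs_def component_sel(3))
  qed
qed

section \<open>Counting labelled stopping sets\<close>

text \<open>Node labels are confined to actual users and slots, which makes this set finite;
  \<open>stopping_sets\<close> bounds only the numbers of nodes.\<close>

definition labelled_stopping_sets :: "nat \<Rightarrow> nat \<Rightarrow> nat \<Rightarrow> (nat, nat) bgraph set" where
  "labelled_stopping_sets q m n =
     {H. stopping_set H \<and> VN H \<subseteq> {..<m} \<and> CN H \<subseteq> {..<n} \<and> (\<forall>v\<in>VN H. vdeg H v \<le> q)}"

lemma finite_labelled_stopping_sets: "finite (labelled_stopping_sets q m n)"
proof (rule finite_subset)
  show "labelled_stopping_sets q m n \<subseteq> (\<lambda>(V, C, E). \<lparr>VN = V, CN = C, edges = E\<rparr>) `
      (Pow {..<m} \<times> Pow {..<n} \<times> Pow ({..<m} \<times> {..<n}))"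
  proof
    fix S assume "S \<in> labelled_stopping_sets q m n"
    then show "S \<in> (\<lambda>(V, C, E). \<lparr>VN = V, CN = C, edges = E\<rparr>) `
        (Pow {..<m} \<times> Pow {..<n} \<times> Pow ({..<m} \<times> {..<n}))"
      by (intro image_eqI[where x = "(VN S, CN S, edges S)"])
        (force simp: labelled_stopping_sets_def stopping_set_def fin_bgraph_def)+
  qed
qed auto

lemma labelled_stopping_sets_subset: "labelled_stopping_sets q m n \<subseteq> stopping_sets q m n"
proof
  fix H assume H: "H \<in> labelled_stopping_sets q m n"
  then have "card (VN H) \<le> card {..<m}" "card (CN H) \<le> card {..<n}"
    by (intro card_mono; simp add: labelled_stopping_sets_def)+
  with H show "H \<in> stopping_sets q m n"
    by (simp add: labelled_stopping_sets_def stopping_sets_def \<nu>_def \<mu>_def)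
qed

text \<open>If \<open>v\<close> differs from \<open>u\<close>, a path from \<open>v\<close> to
  \<open>u\<close> begins with an edge at \<open>v\<close>. This excludes degree 0, which the
  products over \<open>k=1..q\<close> in \<open>\<alpha>\<close> and \<open>\<gamma>\<close> do not
  cover; a lone VN without edges is itself a stopping set.\<close>

lemma stopping_set_vdeg_pos:
  assumes S: "stopping_set S" and u: "u \<in> VN S" "vdeg S u > 0" and v: "v \<in> VN S"
  shows "vdeg S v > 0"
proof (cases "v = u")
  case False
  have "(Inl v, Inl u) \<in> (adjacent S)\<^sup>*"
    using S u v by (auto simp: stopping_set_def connected_bgraph_def nodes_def)
  then obtain y where "(Inl v, y) \<in> adjacent S"
    using False by (cases rule: converse_rtranclE) auto
  then obtain c where "(v, c) \<in> edges S" by (cases y) auto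
  moreover have "finite {c. (v, c) \<in> edges S}"
    using S by (auto simp: stopping_set_def fin_bgraph_def intro: finite_subset[of _ "CN S"])
  ultimately show ?thesis by (auto simp: vdeg_def card_gt_0_iff)
qed (use u in simp)

section \<open>Products and assignments with prescribed degree counts\<close>

lemma prod_by_degree:
  fixes f :: "nat \<Rightarrow> 'a :: comm_monoid_mult"
  assumes "finite V" "\<delta> ` V \<subseteq> K" "finite K"
  shows "(\<Prod>v\<in>V. f (\<delta> v)) = (\<Prod>k\<in>K. f k ^ card {v \<in> V. \<delta> v = k})"
proof -
  have "(\<Prod>v\<in>V. f (\<delta> v)) = (\<Prod>k\<in>K. \<Prod>v\<in>{v \<in> V. \<delta> v = k}. f (\<delta> v))"
    using assms by (intro prod.group[symmetric])
  also have "\<dots> = (\<Prod>k\<in>K. f k ^ card {v \<in> V. \<delta> v = k})"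
    by (intro prod.cong refl) (simp add: prod_constant)
  finally show ?thesis .
qed

text \<open>Listing \<open>V\<close> turns such a function into an arrangement of the multiset of
  values of \<open>\<delta>0\<close> on \<open>W\<close>, and arrangements are counted by a
  multinomial coefficient. Injectivity of this encoding suffices for the upper bound. The factorials
  stand on the left to avoid division in \<open>nat\<close>.\<close>

lemma card_functions_with_fibre_sizes:
  fixes \<delta>0 :: "'a \<Rightarrow> 'b" and V :: "'c set"
  assumes W: "finite W" and V: "finite V" and K: "finite K" "\<delta>0 ` W \<subseteq> K"
  defines "D \<equiv> {\<delta> \<in> extensional V. \<forall>k. card {v \<in> V. \<delta> v = k} = card {w \<in> W. \<delta>0 w = k}}"
  shows "finite D"
    and "card D * (\<Prod>k\<in>K. fact (card {w \<in> W. \<delta>0 w = k})) \<le> fact (card W)"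
proof -
  define M where "M = image_mset \<delta>0 (mset_set W)"
  have count_M: "count M k = card {w \<in> W. \<delta>0 w = k}" for k
    using W by (simp add: M_def count_image_mset_eq_card_vimage)
  obtain vs where vs: "set vs = V" "distinct vs"
    using finite_distinct_list[OF V] by blast
  have inj: "inj_on (\<lambda>\<delta>. map \<delta> vs) D"
  proof (rule inj_onI)
    fix \<delta> \<delta>' assume *: "\<delta> \<in> D" "\<delta>' \<in> D" "map \<delta> vs = map \<delta>' vs"
    then show "\<delta> = \<delta>'" using vs by (intro extensionalityI[of _ V]) (auto simp: D_def)
  qed
  have sub: "(\<lambda>\<delta>. map \<delta> vs) ` D \<subseteq> permutations_of_multiset M"
  proof (rule image_subsetI)
    fix \<delta> assume \<delta>: "\<delta> \<in> D"
    have "count (mset (map \<delta> vs)) k = count M k" for k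
    proof -
      have "count (mset (map \<delta> vs)) k = length (filter (\<lambda>v. \<delta> v = k) vs)"
        by (induction vs) auto
      also have "\<dots> = card {v \<in> V. \<delta> v = k}"
        using vs by (metis distinct_card distinct_filter set_filter)
      also have "\<dots> = count M k" using \<delta> by (simp add: D_def count_M)
      finally show ?thesis .
    qed
    then have "mset (map \<delta> vs) = M" by (rule multiset_eqI)
    then show "map \<delta> vs \<in> permutations_of_multiset M"
      by (simp add: permutations_of_multiset_def)
  qed
  show "finite D"
    using finite_imageD[OF finite_subset[OF sub] inj] by simp
  have "card D \<le> card (permutations_of_multiset M)"
    using inj sub by (intro card_inj_on_le) auto
  \<comment> \<open>Indices of \<open>K\<close> outside the multiset have count 0 and contribute
    \<open>fact 0 = 1\<close>.\<close>
  moreover have "(\<Prod>k\<in>K. fact (card {w \<in> W. \<delta>0 w = k}) :: nat) = (\<Prod>k\<in>set_mset M. fact (count M k))"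
    unfolding count_M[symmetric]
    using K W by (intro prod.mono_neutral_right) (auto simp: not_in_iff, auto simp: M_def)
  moreover have "card (permutations_of_multiset M) * (\<Prod>k\<in>set_mset M. fact (count M k)) = fact (card W)"
    using card_permutations_of_multiset_aux[of M] by (simp add: M_def)
  ultimately show "card D * (\<Prod>k\<in>K. fact (card {w \<in> W. \<delta>0 w = k})) \<le> fact (card W)"
    by (metis mult_le_mono1)
qed

text \<open>By \<open>card_labelled_copies\<close>, each choice of user set, slot set and degree
  assignment admits exactly \<open>c_num S\<close> copies, whatever the labels; covering by these
  families gives the bound. Degrees in \<open>{1..q}\<close> let the factorials over
  \<open>k=1..q\<close> account for all users.\<close>

lemma card_labelled_stopping_sets_iso:
  fixes S :: "(nat, nat) bgraph"
  assumes S: "fin_bgraph S" and deg: "\<forall>v\<in>VN S. vdeg S v \<in> {1..q}"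
  shows "card {H \<in> labelled_stopping_sets q m n. bgraph_iso H S} * (\<Prod>k=1..q. fact (v_num k S))
    \<le> (m choose \<nu> S) * (n choose \<mu> S) * fact (\<nu> S) * c_num S"
proof -
  define \<V> where "\<V> = {V. V \<subseteq> {..<m} \<and> card V = \<nu> S}"
  define \<C> where "\<C> = {C. C \<subseteq> {..<n} \<and> card C = \<mu> S}"
  define D where "D V = {\<delta> \<in> extensional V. \<forall>k. card {v \<in> V. \<delta> v = k} = v_num k S}" for V :: "nat set"
  define P where "P = (\<Prod>k=1..q. fact (v_num k S) :: nat)"
  have cards: "card \<V> = m choose \<nu> S" "card \<C> = n choose \<mu> S"
    unfolding \<V>_def \<C>_def using n_subsets[of "{..<m}"] n_subsets[of "{..<n}"] by auto
  have finVC: "finite \<V>" "finite \<C>" by (auto simp: \<V>_def \<C>_def)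
  have finV: "finite V" if "V \<in> \<V>" for V
    using that by (auto simp: \<V>_def intro: finite_subset)
  have D: "finite (D V)" "card (D V) * P \<le> fact (\<nu> S)" if "V \<in> \<V>" for V
  proof -
    have "finite (VN S)" "vdeg S ` VN S \<subseteq> {1..q}"
      using S deg by (auto simp: fin_bgraph_def)
    from card_functions_with_fibre_sizes[OF this(1) finV[OF that] _ this(2)]
    show "finite (D V)" "card (D V) * P \<le> fact (\<nu> S)"
      by (simp_all add: D_def P_def v_num_def \<nu>_def)
  qed
  define I where "I = (SIGMA V:\<V>. \<C> \<times> D V)"
  define L :: "nat set \<times> nat set \<times> (nat \<Rightarrow> nat) \<Rightarrow> (nat, nat) bgraph set"
    where "L = (\<lambda>(V, C, \<delta>). labelled_copies V C \<delta> S)"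
  have finI: "finite I" using finVC D by (auto simp: I_def)
  have L: "card (L i) = c_num S" "finite (L i)" if iI: "i \<in> I" for i
  proof -
    obtain V C \<delta> where i: "i = (V, C, \<delta>)" "V \<in> \<V>" "C \<in> \<C>" "\<delta> \<in> D V"
      using iI by (auto simp: I_def)
    then have fin: "finite V" "finite C" by (auto simp: \<V>_def \<C>_def intro: finite_subset)
    show "card (L i) = c_num S"
      using i fin by (simp add: L_def) (intro card_labelled_copies[OF S]; simp add: \<C>_def D_def)
    have "L i \<subseteq> (\<lambda>E. \<lparr>VN = V, CN = C, edges = E\<rparr>) ` Pow (V \<times> C)"
    proof
      fix H assume "H \<in> L i"
      then show "H \<in> (\<lambda>E. \<lparr>VN = V, CN = C, edges = E\<rparr>) ` Pow (V \<times> C)"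
        by (intro image_eqI[where x = "edges H"])
          (auto simp: L_def i labelled_copies_def fin_bgraph_def)
    qed
    then show "finite (L i)" using fin by (auto intro: finite_subset)
  qed
  have "{H \<in> labelled_stopping_sets q m n. bgraph_iso H S} \<subseteq> (\<Union>i\<in>I. L i)"
  proof
    fix H assume "H \<in> {H \<in> labelled_stopping_sets q m n. bgraph_iso H S}"
    then have H: "fin_bgraph H" "VN H \<subseteq> {..<m}" "CN H \<subseteq> {..<n}" "bgraph_iso H S"
      by (auto simp: labelled_stopping_sets_def stopping_set_def)
    note inv = iso_invariant[OF H(1) S H(4)]
    \<comment> \<open>Cutting \<open>vdeg H\<close> off outside \<open>VN H\<close> makes it
      extensional, as membership in \<open>D (VN H)\<close> demands; isomorphism invariance supplies
      the counts.\<close>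
    define \<delta> where "\<delta> = restrict (vdeg H) (VN H)"
    have "{v \<in> VN H. \<delta> v = k} = {v \<in> VN H. vdeg H v = k}" for k
      by (auto simp: \<delta>_def)
    then have "\<delta> \<in> D (VN H)"
      using inv by (auto simp: D_def v_num_def \<delta>_def)
    then have "(VN H, CN H, \<delta>) \<in> I"
      using H inv by (auto simp: I_def \<V>_def \<C>_def \<nu>_def \<mu>_def)
    moreover have "H \<in> L (VN H, CN H, \<delta>)"
      using H by (simp add: L_def labelled_copies_def \<delta>_def)
    ultimately show "H \<in> (\<Union>i\<in>I. L i)" by blast
  qed
  then have "card {H \<in> labelled_stopping_sets q m n. bgraph_iso H S} \<le> card (\<Union>i\<in>I. L i)"
    using finI L by (intro card_mono) auto
  also have "\<dots> \<le> (\<Sum>i\<in>I. card (L i))" by (rule card_UN_le[OF finI])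
  also have "\<dots> = card I * c_num S" using L by simp
  finally have "card {H \<in> labelled_stopping_sets q m n. bgraph_iso H S} * P \<le> card I * P * c_num S"
    by (metis mult.assoc mult.commute mult_le_mono1)
  \<comment> \<open>The slot set is chosen independently of the rest, and for each user set the
    multinomial bound replaces \<open>card (D V) * P\<close> by
    \<open>fact (\<nu> S)\<close>.\<close>
  also have "card I * P \<le> (m choose \<nu> S) * (n choose \<mu> S) * fact (\<nu> S)"
  proof -
    have "card I * P = (\<Sum>V\<in>\<V>. card \<C> * (card (D V) * P))"
      unfolding I_def using finVC D
      by (subst card_SigmaI) (auto simp: card_cartesian_product sum_distrib_right mult.assoc)
    also have "\<dots> \<le> (\<Sum>V\<in>\<V>. card \<C> * fact (\<nu> S))"
      using D by (intro sum_mono mult_le_mono2) auto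
    finally show ?thesis by (simp add: cards mult_ac)
  qed
  finally show ?thesis by (simp add: P_def)
qed

section \<open>The union bound\<close>

text \<open>Users outside \<open>H\<close> are unconstrained and may also transmit in its slots, so
  by independence the probability of this event is a product over the users of \<open>H\<close>
  alone.\<close>

definition occurs :: "(nat, nat) bgraph \<Rightarrow> (nat \<Rightarrow> nat set) set" where
  "occurs H = {T. \<forall>v\<in>VN H. T v = nbrs H v}"

lemma card_unresolved_le:
  assumes T: "\<And>u. u < m \<Longrightarrow> T u \<subseteq> {..<n} \<and> card (T u) \<le> q"
  defines "G \<equiv> transmission_graph m n T"
  shows "real (card {u \<in> unresolved G. vdeg G u = d}) \<le>
    (\<Sum>H\<in>labelled_stopping_sets q m n. real (v_num d H) * indicator (occurs H) T)"
proof -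
  define \<H> where "\<H> = {H \<in> labelled_stopping_sets q m n. T \<in> occurs H}"
  have fin: "finite \<H>" using finite_labelled_stopping_sets by (simp add: \<H>_def)
  have G: "fin_bgraph G"
    by (auto simp: G_def transmission_graph_def fin_bgraph_def)
  have nG: "nbrs G u = T u" if "u < m" for u
    using T[OF that] that by (auto simp: G_def transmission_graph_def nbrs_def)
  have "{u \<in> unresolved G. vdeg G u = d} \<subseteq> (\<Union>H\<in>\<H>. {v \<in> VN H. vdeg H v = d})"
  proof
    fix u assume u: "u \<in> {u \<in> unresolved G. vdeg G u = d}"
    then obtain H where H: "stopping_set H" "VN H \<subseteq> VN G" "CN H \<subseteq> CN G" "u \<in> VN H"
      "\<And>v. v \<in> VN H \<Longrightarrow> nbrs H v = nbrs G v"
      using unresolved_in_stopping_set[OF G] by (metis (mono_tags, lifting) mem_Collect_eq)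
    have VH: "v < m" if "v \<in> VN H" for v
      using that H(2) by (auto simp: G_def transmission_graph_def)
    \<comment> \<open>Neighbourhoods in \<open>H\<close> are the transmission sets, so the bound
      \<open>q\<close> on the sizes of the latter bounds the degrees in \<open>H\<close>.\<close>
    have "H \<in> \<H>"
      using H VH nG T
      by (auto simp: \<H>_def labelled_stopping_sets_def occurs_def vdeg_eq_card_nbrs
          G_def transmission_graph_def)
    moreover have "vdeg H u = d" using u H by (simp add: vdeg_eq_card_nbrs)
    ultimately show "u \<in> (\<Union>H\<in>\<H>. {v \<in> VN H. vdeg H v = d})" using H by blast
  qed
  moreover have "finite (VN H)" if "H \<in> \<H>" for H
    using that by (auto simp: \<H>_def labelled_stopping_sets_def intro: finite_subset)
  ultimately have "card {u \<in> unresolved G. vdeg G u = d} \<le> card (\<Union>H\<in>\<H>. {v \<in> VN H. vdeg H v = d})"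
    using fin by (intro card_mono) auto
  also have "\<dots> \<le> (\<Sum>H\<in>\<H>. v_num d H)"
    unfolding v_num_def by (rule card_UN_le[OF fin])
  finally have "real (card {u \<in> unresolved G. vdeg G u = d}) \<le> (\<Sum>H\<in>\<H>. real (v_num d H))"
    by (metis of_nat_le_iff of_nat_sum)
  also have "\<dots> = (\<Sum>H\<in>labelled_stopping_sets q m n. real (v_num d H) * indicator (occurs H) T)"
    unfolding \<H>_def using finite_labelled_stopping_sets
    by (intro sum.mono_neutral_cong_left) auto
  finally show ?thesis .
qed

lemma prob_occurs:
  assumes "set_pmf lam \<subseteq> {0..n}" and H: "H \<in> labelled_stopping_sets q m n"
  shows "measure_pmf.prob (Pi_pmf {..<m} {} (\<lambda>_. user_pmf n lam)) (occurs H) =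
    (\<Prod>v\<in>VN H. pmf lam (vdeg H v) / real (n choose vdeg H v))"
proof -
  have "nbrs H v \<subseteq> {..<n}" for v
    using H by (auto simp: nbrs_def labelled_stopping_sets_def stopping_set_def fin_bgraph_def)
  then show ?thesis
    using H unfolding occurs_def
    by (subst prob_Pi_pmf_agree)
      (auto simp: labelled_stopping_sets_def pmf_user_pmf[OF assms(1)] vdeg_eq_card_nbrs)
qed

lemma expected_unresolved_le:
  assumes lam: "set_pmf lam \<subseteq> {0..q}" and qn: "q \<le> n"
  shows "expected_unresolved m n lam d \<le>
    (\<Sum>H\<in>labelled_stopping_sets q m n.
       real (v_num d H) * (\<Prod>v\<in>VN H. pmf lam (vdeg H v) / real (n choose vdeg H v)))"
proof -
  define P where "P = Pi_pmf {..<m} {} (\<lambda>_. user_pmf n lam)"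
  let ?f = "\<lambda>T. real (card {u \<in> unresolved (transmission_graph m n T).
                             vdeg (transmission_graph m n T) u = d})"
  let ?g = "\<lambda>T. \<Sum>H\<in>labelled_stopping_sets q m n. real (v_num d H) * indicator (occurs H) T :: real"
  have lam': "set_pmf lam \<subseteq> {0..n}" using lam qn by auto
  have setP: "set_pmf P = PiE_dflt {..<m} {} (\<lambda>_. set_pmf (user_pmf n lam))"
    unfolding P_def by (simp add: set_Pi_pmf comp_def)
  \<comment> \<open>Finite support makes both integrands integrable.\<close>
  have "finite (set_pmf (user_pmf n lam))"
    using set_user_pmf[OF lam qn] by (rule finite_subset) simp
  then have finP: "finite (set_pmf P)"
    unfolding setP by (intro finite_PiE_dflt) auto
  \<comment> \<open>The pointwise bound is available on the support, where transmission sets consist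
    of at most \<open>q\<close> of the \<open>n\<close> slots.\<close>
  have le: "?f T \<le> ?g T" if "T \<in> set_pmf P" for T
    using that set_user_pmf[OF lam qn] unfolding setP
    by (intro card_unresolved_le) (auto simp: PiE_dflt_def)
  have "expected_unresolved m n lam d = measure_pmf.expectation P ?f"
    by (simp add: expected_unresolved_def csa_graph_def P_def)
  also have "\<dots> \<le> measure_pmf.expectation P ?g"
    using le by (intro integral_mono_AE integrable_measure_pmf_finite[OF finP]) (simp add: AE_measure_pmf_iff)
  also have "\<dots> = (\<Sum>H\<in>labelled_stopping_sets q m n. real (v_num d H) * measure_pmf.prob P (occurs H))"
    by (subst Bochner_Integration.integral_sum) (auto intro: integrable_measure_pmf_finite[OF finP])
  finally show ?thesis
    unfolding P_def using prob_occurs[OF lam'] by simp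
qed

text \<open>All labelled members of a class share one summand, so the class contributes that value
  times its size; the bound on the size supplies the factorials, \<open>\<beta>\<close> and
  \<open>c_num\<close>.\<close>

lemma sum_class_le:
  fixes S :: "(nat, nat) bgraph"
  assumes qn: "q \<le> n" and d: "d \<ge> 1" and S: "S \<in> stopping_sets q m n"
  shows "(\<Sum>H | H \<in> labelled_stopping_sets q m n \<and> bgraph_iso H S.
       real (v_num d H) * (\<Prod>v\<in>VN H. pmf lam (vdeg H v) / real (n choose vdeg H v)))
    \<le> real (v_num d S) * \<alpha> q m lam S * \<beta> n S * \<gamma> q n S" (is "sum ?F ?X \<le> _")
\<comment> \<open>Classes without a user of degree \<open>d\<close> contribute 0 on both sides. In
  the others \<open>d \<ge> 1\<close> provides a user of positive degree, hence all degrees lie in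
  \<open>{1..q}\<close>.\<close>
proof (cases "v_num d S = 0")
  case True
  have "?F H = 0" if "H \<in> ?X" for H
    using that True S iso_invariant(1)[of H S d]
    by (auto simp: labelled_stopping_sets_def stopping_sets_def stopping_set_def)
  then have "sum ?F ?X = 0" by (intro sum.neutral) blast
  then show ?thesis by (simp add: True)
next
  case False
  have st: "stopping_set S" and finS: "fin_bgraph S" "finite (VN S)" and \<nu>: "\<nu> S \<le> m"
    using S by (auto simp: stopping_sets_def stopping_set_def fin_bgraph_def)
  define h where "h k = pmf lam k / real (n choose k)" for k
  obtain u where "u \<in> VN S" "vdeg S u = d"
    using False by (auto simp: v_num_def card_eq_0_iff)
  with stopping_set_vdeg_pos[OF st] d S have deg: "\<forall>v\<in>VN S. vdeg S v \<in> {1..q}"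
    by (force simp: stopping_sets_def)
  have F: "?F H = real (v_num d S) * (\<Prod>k=1..q. h k ^ v_num k S)" if H: "H \<in> ?X" for H
  proof -
    have finH: "fin_bgraph H" "finite (VN H)" and st': "stopping_set H"
      using H by (auto simp: labelled_stopping_sets_def stopping_set_def fin_bgraph_def)
    have "bgraph_iso H S" using H by simp
    note inv = iso_invariant[OF finH(1) finS(1) this]
    have "v_num d H \<noteq> 0" using False inv by simp
    then obtain u where "u \<in> VN H" "vdeg H u = d"
      by (auto simp: v_num_def card_eq_0_iff)
    with stopping_set_vdeg_pos[OF st'] d H have "vdeg H ` VN H \<subseteq> {1..q}"
      by (force simp: labelled_stopping_sets_def)
    from prod_by_degree[OF finH(2) this, of h] show ?thesis
      by (simp add: h_def inv flip: v_num_def)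
  qed
  define P where "P = (\<Prod>k=1..q. fact (v_num k S) :: real)"
  have P: "P > 0" unfolding P_def by (intro prod_pos) auto
  have "real (card ?X * (\<Prod>k=1..q. fact (v_num k S))) \<le>
      real ((m choose \<nu> S) * (n choose \<mu> S) * fact (\<nu> S) * c_num S)"
    using card_labelled_stopping_sets_iso[OF finS(1) deg] by (simp only: of_nat_le_iff)
  then have "real (card ?X) * P \<le> real (m choose \<nu> S) * fact (\<nu> S) * real (n choose \<mu> S) * real (c_num S)"
    by (simp add: P_def mult_ac)
  \<comment> \<open>Choosing and then ordering \<open>\<nu> S\<close> users gives the falling
    factorial in \<open>\<alpha>\<close>; \<open>\<nu> S \<le> m\<close> makes the truncated
    subtraction exact.\<close>
  also have "real (m choose \<nu> S) * fact (\<nu> S) = fact m / fact (m - \<nu> S)"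
    using binomial_fact[OF \<nu>, where ?'a = real] by simp
  finally have card: "real (card ?X) \<le> fact m / fact (m - \<nu> S) * \<beta> n S * real (c_num S) / P"
    using P by (simp add: \<beta>_def pos_le_divide_eq mult_ac)
  have "sum ?F ?X = real (v_num d S) * (\<Prod>k=1..q. h k ^ v_num k S) * real (card ?X)"
    using F by (simp add: mult_ac)
  also have "\<dots> \<le> real (v_num d S) * (\<Prod>k=1..q. h k ^ v_num k S) *
      (fact m / fact (m - \<nu> S) * \<beta> n S * real (c_num S) / P)"
    by (intro mult_left_mono card mult_nonneg_nonneg prod_nonneg) (auto simp: h_def)
  \<comment> \<open>The powers of \<open>h\<close> split: the numerators \<open>pmf lam k\<close> go
    with \<open>P\<close> into \<open>\<alpha>\<close>, the binomials with \<open>c_num S\<close>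
    into \<open>\<gamma>\<close>.\<close>
  also have "\<dots> = real (v_num d S) * \<alpha> q m lam S * \<beta> n S * \<gamma> q n S"
    by (simp add: \<alpha>_def \<gamma>_def h_def P_def power_divide prod_dividef mult_ac)
  finally show ?thesis .
qed

theorem mainTheorem3:
  fixes q n m d :: nat and lam :: "nat pmf"
  assumes "q \<ge> 1" and "n \<ge> q" and "m \<ge> 1"
    and "set_pmf lam \<subseteq> {0..q}"
    and "d \<in> {1..q}"
  shows "expected_unresolved m n lam d \<le>
    (\<Sum>X\<in>stopping_classes q m n.
       let S = class_rep X in real (v_num d S) * \<alpha> q m lam S * \<beta> n S * \<gamma> q n S)"
proof -
  let ?L = "labelled_stopping_sets q m n"
  let ?F = "\<lambda>H :: (nat, nat) bgraph.
    real (v_num d H) * (\<Prod>v\<in>VN H. pmf lam (vdeg H v) / real (n choose vdeg H v))"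
  let ?B = "\<lambda>S :: (nat, nat) bgraph. real (v_num d S) * \<alpha> q m lam S * \<beta> n S * \<gamma> q n S"
  have "expected_unresolved m n lam d \<le> sum ?F ?L"
    by (rule expected_unresolved_le[OF assms(4,2)])
  \<comment> \<open>The labelled stopping sets are grouped by isomorphism class; each belongs to
    \<open>stopping_sets q m n\<close>, so its class is among the indices.\<close>
  also have "\<dots> = (\<Sum>X\<in>stopping_classes q m n. \<Sum>H | H \<in> ?L \<and> iso_rel `` {H} = X. ?F H)"
    using labelled_stopping_sets_subset[of q m n]
    by (intro sum.group[symmetric] finite_labelled_stopping_sets finite_stopping_classes)
      (auto simp: stopping_classes_def intro: quotientI)
  also have "\<dots> \<le> (\<Sum>X\<in>stopping_classes q m n. ?B (class_rep X))"
  proof (rule sum_mono)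
    fix X assume "X \<in> stopping_classes q m n"
    then obtain S where S: "S \<in> stopping_sets q m n" and X: "X = iso_rel `` {S}"
      unfolding stopping_classes_def by (auto elim: quotientE)
    have "fin_bgraph S" using S by (simp add: stopping_sets_def stopping_set_def)
    have "{H. H \<in> ?L \<and> iso_rel `` {H} = X} = {H. H \<in> ?L \<and> bgraph_iso H S}"
      using eq_equiv_class_iff[OF equiv_iso_rel, of _ S] \<open>fin_bgraph S\<close>
      by (auto simp: X iso_rel_def labelled_stopping_sets_def stopping_set_def)
    then have "(\<Sum>H | H \<in> ?L \<and> iso_rel `` {H} = X. ?F H) \<le> ?B S"
      using sum_class_le[OF assms(2) _ S, of d lam] assms(5) by simp
    \<comment> \<open>The bound is invariant under isomorphism, so the arbitrary representative
      picked by \<open>class_rep\<close> gives the same value.\<close>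
    also have "\<dots> = ?B (class_rep X)"
      unfolding X by (rule summand_iso_invariant[OF class_rep_stopping_classes[OF S]])
    finally show "(\<Sum>H | H \<in> ?L \<and> iso_rel `` {H} = X. ?F H) \<le> ?B (class_rep X)" .
  qed
  finally show ?thesis by (simp only: Let_def)
qed

end
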